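(* For all $n\in\mathbb{N}$, the Padovan hyperbolic spinors $\psi_n$ and the Perrin hyperbolic spinors $\phi_n$ are given by the $(n+1)\times(n+1)$ determinants $$\psi_n=\begin{vmatrix}\psi_0&-1&0&0&0&\cdots&0&0\\ \psi_1&0&-1&0&0&\cdots&0&0\\ \psi_2&0&0&-1&0&\cdots&0&0\\ 0&1&1&0&-1&\cdots&0&0\\ \vdots&\ddots&\ddots&\ddots&\ddots&\ddots&\vdots&\vdots\\ 0&0&0&0&0&\ddots&0&-1\\ 0&0&0&0&0&\ddots&1&0\end{vmatrix}_{(n+1)\times(n+1)},$$ $$\phi_n=\begin{vmatrix}\phi_0&-1&0&0&0&\cdots&0&0\\ \phi_1&0&-1&0&0&\cdots&0&0\\ \phi_2&0&0&-1&0&\cdots&0&0\\ 0&1&1&0&-1&\cdots&0&0\\ \vdots&\ddots&\ddots&\ddots&\ddots&\ddots&\vdots&\vdots\\ 0&0&0&0&0&\ddots&0&-1\\ 0&0&0&0&0&\ddots&1&0\end{vmatrix}_{(n+1)\times(n+1)}.$$ Explicitly, the matrix $(a_{k,l})_{1\le k,l\le n+1}$ in the first determinant has the entries $a_{1,1}=\psi_0$, $a_{2,1}=\psi_1$, $a_{3,1}=\psi_2$ (those that exist for the given size), $a_{k,k+1}=-1$ for $1\le k\le n$, $a_{k,k-2}=a_{k,k-1}=1$ for $4\le k\le n+1$, and all other entries $0$; the second is the same with $\phi$ in place of $\psi$.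
   Context: Hyperbolic numbers are expressions $a+bj$ with $a,b\in\mathbb{R}$ and a unit $j\notin\mathbb{R}$, $j^2=1$; they form a commutative ring. A hyperbolic spinor is a column vector with two hyperbolic number components, with componentwise addition and scalar multiplication. The Padovan numbers $(P_n)_{n\ge 0}$ are defined by $P_0=P_1=P_2=1$ and $P_{n+3}=P_{n+1}+P_n$ for $n\ge0$. The Perrin numbers $(R_n)_{n\ge 0}$ are defined by $R_0=3$, $R_1=0$, $R_2=2$ and $R_{n+3}=R_{n+1}+R_n$ for $n\ge 0$. The $n$-th Padovan hyperbolic spinor and the $n$-th Perrin hyperbolic spinor are $$\psi_n=\begin{bmatrix}P_n+P_{n+3}j\\ -P_{n+1}+P_{n+2}j\end{bmatrix},\qquad \phi_n=\begin{bmatrix}R_n+R_{n+3}j\\ -R_{n+1}+R_{n+2}j\end{bmatrix}.$$ In the determinants only the first column has spinor entries (a $0$ in the first column is the zero spinor) while all other entries are integers; the determinant is the spinor obtained by Laplace expansion along the first column, $\sum_{k}(-1)^{k+1}M_{k,1}\,a_{k,1}$, where $M_{k,1}$ is the integer minor obtained by deleting row $k$ and column $1$. *)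

theory Defs
  imports
    "HOL-Analysis.Cartesian_Space"
    "Jordan_Normal_Form.Determinant"
begin

datatype hyperbolic = Hyperbolic (hyp_re: real) (hyp_im: real)

instantiation hyperbolic :: comm_ring_1
begin

definition "0 = Hyperbolic 0 0"
definition "1 = Hyperbolic 1 0"
definition "x + y = Hyperbolic (hyp_re x + hyp_re y) (hyp_im x + hyp_im y)"
definition "- x = Hyperbolic (- hyp_re x) (- hyp_im x)"
definition "x - y = Hyperbolic (hyp_re x - hyp_re y) (hyp_im x - hyp_im y)"
definition "x * y =
  Hyperbolic (hyp_re x * hyp_re y + hyp_im x * hyp_im y)
    (hyp_re x * hyp_im y + hyp_im x * hyp_re y)"

instance
  by standard
    (auto simp: zero_hyperbolic_def one_hyperbolic_def plus_hyperbolic_def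
      uminus_hyperbolic_def minus_hyperbolic_def times_hyperbolic_def algebra_simps)

end

definition hyp_unit :: hyperbolic (\<open>\<j>\<close>) where
  "\<j> = Hyperbolic 0 1"

definition hyp_of_real :: "real \<Rightarrow> hyperbolic" where
  "hyp_of_real a = Hyperbolic a 0"

lemma hyp_unit_squared: "\<j>\<^sup>2 = 1"
  by (simp add: hyp_unit_def power2_eq_square times_hyperbolic_def one_hyperbolic_def)

lemma hyp_unit_not_real: "\<j> \<notin> range hyp_of_real"
  by (auto simp: hyp_unit_def hyp_of_real_def)

lemma Hyperbolic_eq: "Hyperbolic a b = hyp_of_real a + hyp_of_real b * \<j>"
  by (simp add: hyp_unit_def hyp_of_real_def plus_hyperbolic_def times_hyperbolic_def)

type_synonym hyperbolic_spinor = "hyperbolic ^ 2"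

fun padovan :: "nat \<Rightarrow> nat" where
  "padovan 0 = 1"
| "padovan (Suc 0) = 1"
| "padovan (Suc (Suc 0)) = 1"
| "padovan (Suc (Suc (Suc n))) = padovan (Suc n) + padovan n"

fun perrin :: "nat \<Rightarrow> nat" where
  "perrin 0 = 3"
| "perrin (Suc 0) = 0"
| "perrin (Suc (Suc 0)) = 2"
| "perrin (Suc (Suc (Suc n))) = perrin (Suc n) + perrin n"

definition padovan_spinor :: "nat \<Rightarrow> hyperbolic_spinor" where
  "padovan_spinor n = vector
     [ of_nat (padovan n) + of_nat (padovan (n + 3)) * \<j>,
       - of_nat (padovan (n + 1)) + of_nat (padovan (n + 2)) * \<j>]"

definition perrin_spinor :: "nat \<Rightarrow> hyperbolic_spinor" where
  "perrin_spinor n = vector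
     [ of_nat (perrin n) + of_nat (perrin (n + 3)) * \<j>,
       - of_nat (perrin (n + 1)) + of_nat (perrin (n + 2)) * \<j>]"

(* Determinant of a square matrix with spinors c 1, c 2, ... in the first column and the integer
   entries of A elsewhere, by Laplace expansion along the first column. The first column of A is
   only a placeholder: every minor deletes it. Rows of the column c are counted from 1, while
   indices of mat start at 0. *)
definition spinor_det :: "(nat \<Rightarrow> hyperbolic_spinor) \<Rightarrow> int mat \<Rightarrow> hyperbolic_spinor" where
  "spinor_det c A =
     (\<Sum>k = 1..dim_row A. of_int ((- 1) ^ (k + 1) * det (mat_delete A (k - 1) 0)) *s c k)"

definition spinor_column :: "(nat \<Rightarrow> hyperbolic_spinor) \<Rightarrow> nat \<Rightarrow> hyperbolic_spinor" where
  "spinor_column \<psi> k = (if k \<in> {1, 2, 3} then \<psi> (k - 1) else 0)"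

(* Integer entry in row k and column l, both counted from 1, for l > 1. *)
definition band_entry :: "nat \<Rightarrow> nat \<Rightarrow> int" where
  "band_entry k l =
     (if l = k + 1 then - 1
      else if k \<ge> 4 \<and> (l = k - 2 \<or> l = k - 1) then 1
      else 0)"

definition band_mat :: "nat \<Rightarrow> int mat" where
  "band_mat m = mat m m (\<lambda>(i, j). band_entry (i + 1) (j + 1))"

end

theory Submission
  imports Defs
begin

text \<open>
  Let \<open>w\<^sub>k\<close> be the cofactors of the first column. Adding to the first column \<open>\<psi>\<^sub>l\<^sub>-\<^sub>2\<close> times
  column \<open>l\<close>, for every \<open>l \<ge> 2\<close>, turns it by the recurrence into
  the column whose only nonzero entry is \<open>\<psi>\<^sub>n\<close>, in the last row. The determinant does not change,
  since \<open>w\<close> is orthogonal to all the other columns; and the last entry of \<open>w\<close> is \<open>1\<close>, because the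
  corresponding minor is lower triangular with \<open>-1\<close> on the diagonal.
\<close>

text \<open>The sum is an off-diagonal entry of \<open>adj_mat A * A\<close>, which is
  \<open>det A\<close> times the identity.\<close>

lemma cofactor_sum_other_column:
  fixes A :: "'a::comm_ring_1 mat"
  assumes A: "A \<in> carrier_mat m m" and "j < m" "l < m" "j \<noteq> l"
  shows "(\<Sum>i<m. cofactor A i l * A $$ (i, j)) = 0"
proof -
  have "(\<Sum>i<m. cofactor A i l * A $$ (i, j)) = (adj_mat A * A) $$ (l, j)"
    using assms by (auto simp: adj_mat_def scalar_prod_def lessThan_atLeast0 intro!: sum.cong)
  also have "\<dots> = 0"
    using assms by (simp add: adj_mat(3)[OF A])
  finally show ?thesis .
qed

lemma band_mat_carrier: "band_mat m \<in> carrier_mat m m"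
  by (simp add: band_mat_def)

lemma band_mat_index:
  assumes "i < m" "j < m"
  shows "band_mat m $$ (i, j) =
    (if j = i + 1 then - 1 else if 3 \<le> i \<and> (j = i - 2 \<or> j = i - 1) then 1 else 0)"
  using assms by (auto simp: band_mat_def band_entry_def)

lemma cofactor_band_mat_last: "cofactor (band_mat (n + 1)) n 0 = 1"
proof -
  define B where "B = mat_delete (band_mat (n + 1)) n 0"
  have B: "B \<in> carrier_mat n n"
    using mat_delete_carrier[OF band_mat_carrier, of "n + 1" n 0] by (simp add: B_def)
  have idx: "B $$ (i, j) = band_mat (n + 1) $$ (i, j + 1)" if "i < n" "j < n" for i j
    using that by (simp add: B_def mat_delete_def band_mat_def)
  have upper: "B $$ (i, j) = 0" if "i < j" "j < n" for i j
    using that idx[of i j] band_mat_index[of i "n + 1" "j + 1"] by auto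
  have diagonal: "B $$ (i, i) = - 1" if "i < n" for i
    using that idx[of i i] band_mat_index[of i "n + 1" "i + 1"] by auto
  have "det B = prod_list (diag_mat B)"
    by (rule det_lower_triangular[OF upper B])
  also have "diag_mat B = replicate n (- 1)"
    using B by (intro nth_equalityI) (simp_all add: diag_mat_def diagonal)
  finally have "det B = (- 1) ^ n"
    by simp
  \<comment> \<open>The cofactor carries the sign \<open>(-1) ^ (n + 0)\<close>, which cancels this
    power.\<close>
  then show ?thesis
    unfolding cofactor_def B_def[symmetric] by simp
qed

text \<open>Row \<open>i\<close> of the column operation, counted from 0. The superdiagonal entry
  contributes \<open>- g i\<close>; it cancels \<open>g i\<close>, which is the column entry if
  \<open>i < 3\<close> and the recurrence sum otherwise. The last row has no superdiagonal entry, so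
  \<open>g n\<close> survives there.\<close>

lemma band_mat_row_sum:
  fixes g :: "nat \<Rightarrow> 'a::comm_ring_1"
  assumes rec: "\<And>k. g (k + 3) = g (k + 1) + g k" and "i \<le> n"
  shows "(if i < 3 then g i else 0) + (\<Sum>j\<in>{1..n}. of_int (band_mat (n + 1) $$ (i, j)) * g (j - 1)) =
    (if i = n then g n else 0)"
proof -
  have "(\<Sum>j\<in>{1..n}. of_int (band_mat (n + 1) $$ (i, j)) * g (j - 1)) =
    (\<Sum>j\<in>{1..n}. (if j = i + 1 then - g i else 0) + (if j = i - 2 then if 3 \<le> i then g (i - 3) else 0 else 0)
      + (if j = i - 1 then if 3 \<le> i then g (i - 2) else 0 else 0))"
    using \<open>i \<le> n\<close> by (intro sum.cong) (auto simp: band_mat_index numeral_eq_Suc)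
  also have "\<dots> = (if i < n then - g i else 0) + (if 3 \<le> i then g (i - 3) + g (i - 2) else 0)"
    using \<open>i \<le> n\<close> by (auto simp: sum.distrib)
  finally show ?thesis
    using rec[of "i - 3"] \<open>i \<le> n\<close> by (auto simp: numeral_eq_Suc Suc_diff_Suc)
qed

text \<open>Stated for a ring-valued \<open>g\<close> so that it applies to each component of a
  spinor.\<close>

lemma cofactor_sum_recurrence:
  fixes g :: "nat \<Rightarrow> 'a::comm_ring_1"
  assumes rec: "\<And>k. g (k + 3) = g (k + 1) + g k"
  shows "(\<Sum>i\<le>n. of_int (cofactor (band_mat (n + 1)) i 0) * (if i < 3 then g i else 0)) = g n"
proof -
  let ?A = "band_mat (n + 1)"
  let ?w = "\<lambda>i. of_int (cofactor ?A i 0) :: 'a"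
  have "(\<Sum>i\<le>n. ?w i * (\<Sum>j\<in>{1..n}. of_int (?A $$ (i, j)) * g (j - 1))) =
    (\<Sum>j\<in>{1..n}. of_int (\<Sum>i\<le>n. cofactor ?A i 0 * ?A $$ (i, j)) * g (j - 1))"
    unfolding sum_distrib_left of_int_sum sum_distrib_right
    by (subst sum.swap) (simp add: mult.assoc)
  also have "\<dots> = 0"
    using cofactor_sum_other_column[OF band_mat_carrier, of _ "n + 1" 0]
    by (intro sum.neutral) (simp add: lessThan_Suc_atMost)
  finally have "(\<Sum>i\<le>n. ?w i * (if i < 3 then g i else 0)) =
    (\<Sum>i\<le>n. ?w i * ((if i < 3 then g i else 0) + (\<Sum>j\<in>{1..n}. of_int (?A $$ (i, j)) * g (j - 1))))"
    unfolding distrib_left sum.distrib by simp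
  also have "\<dots> = (\<Sum>i\<le>n. ?w i * (if i = n then g n else 0))"
    using band_mat_row_sum[of g _ n, OF rec] by (intro sum.cong) simp_all
  also have "\<dots> = (\<Sum>i\<le>n. if i = n then ?w n * g n else 0)"
    by (intro sum.cong) auto
  also have "\<dots> = g n"
    using cofactor_band_mat_last[of n] by simp
  finally show ?thesis .
qed

lemma spinor_det_recurrence:
  assumes "\<And>k. s (k + 3) = s (k + 1) + s k"
  shows "spinor_det (spinor_column s) (band_mat (n + 1)) = s n"
proof -
  have "spinor_det (spinor_column s) (band_mat (n + 1)) $ r = s n $ r" for r
  proof -
    have "spinor_det (spinor_column s) (band_mat (n + 1)) $ r =
      (\<Sum>i\<le>n. of_int (cofactor (band_mat (n + 1)) i 0) * (if i < 3 then s i $ r else 0))"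
      unfolding spinor_det_def sum_component
      \<comment> \<open>Rows pass from counting from 1 to counting from 0; with
        \<open>k = i + 1\<close> the sign \<open>(-1) ^ (k + 1)\<close> equals
        \<open>(-1) ^ (i + 0)\<close>, that of the cofactor.\<close>
      by (rule sum.reindex_bij_witness[of _ Suc "\<lambda>k. k - 1"])
        (auto simp: band_mat_def cofactor_def spinor_column_def)
    also have "\<dots> = s n $ r"
      by (rule cofactor_sum_recurrence) (simp add: assms)
    finally show ?thesis .
  qed
  then show ?thesis
    by (simp add: Finite_Cartesian_Product.vec_eq_iff)
qed

lemma padovan_spinor_rec: "padovan_spinor (k + 3) = padovan_spinor (k + 1) + padovan_spinor k"
  by (simp add: padovan_spinor_def Finite_Cartesian_Product.vec_eq_iff forall_2 numeral_eq_Suc plus_1_eq_Suc distrib_right)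

lemma perrin_spinor_rec: "perrin_spinor (k + 3) = perrin_spinor (k + 1) + perrin_spinor k"
  by (simp add: perrin_spinor_def Finite_Cartesian_Product.vec_eq_iff forall_2 numeral_eq_Suc plus_1_eq_Suc distrib_right)

theorem theorem20:
  fixes n :: nat
  shows "padovan_spinor n = spinor_det (spinor_column padovan_spinor) (band_mat (n + 1)) \<and>
         perrin_spinor n = spinor_det (spinor_column perrin_spinor) (band_mat (n + 1))"
  by (simp only: spinor_det_recurrence[of padovan_spinor, OF padovan_spinor_rec]
      spinor_det_recurrence[of perrin_spinor, OF perrin_spinor_rec])

end
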